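(* For every positive integer $n$, the extra slow Tamari lattice $\operatorname{esTam}_n$ has exactly $2\binom n2+\binom{n-1}2$ meet-irreducible elements.
   Context: Let $n$ be a positive integer. The board of size $n$ is the Ferrers diagram of shape $(n,n,n-1,n-2,\dots,3,2)$ (a single cell $(1,1)$ if $n=1$). Its cells are written $(i,j)$, where $i$ is the row, numbered from the top, and $j$ is the column label, the columns being labelled $n,n-1,\dots,1$ from left to right. So the cells are $(1,j)$ for $1\le j\le n$ and $(i,j)$ for $2\le i\le n$, $i-1\le j\le n$. The root is $(1,n)$ (top-left cell); the border cells are $(i,i-1)$ for $2\le i\le n$ (the rightmost cells of rows $2,\dots,n$). An fb-tableau of size $n$ is a filling in which each cell is either empty or nonempty such that the root and all border cells are nonempty, and every nonempty cell other than the root has a nonempty cell strictly to its left in the same row or strictly above it in the same column. In an fb-tableau, a nonempty cell different from the root is called a left-arrow if there is no nonempty cell strictly to its left in its row, an up-arrow if there is no nonempty cell strictly above it in its column, and a dot otherwise; the root is also a dot. (Each of rows $2,\dots,n$ has exactly one left-arrow, each of columns $1,\dots,n-1$ has exactly one up-arrow.) A cell is free in $T$ if it lies strictly below an up-arrow (same column) and strictly to the right of a left-arrow (same row); a free cell is either empty or contains a dot. $\operatorname{Row}(T)$ is the set of cells lying weakly to the right of a left-arrow or of the root in the same row; $\operatorname{Col}(T)$ is the set of cells lying weakly below an up-arrow or the root in the same column. For fb-tableaux $S,T$ of size $n$, write $S\lhd T$ if (1) $\operatorname{Col}(S)\subseteq\operatorname{Col}(T)$; (2) $\operatorname{Row}(T)\subseteq\operatorname{Row}(S)$;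 (3) for every cell $c$ that is free in both $S$ and $T$, if $c$ contains a dot in $S$ then $c$ contains a dot in $T$. The extra slow Tamari lattice $\operatorname{esTam}_n$ is the set of fb-tableaux of size $n$ ordered by $\lhd$; it is a finite lattice. An element is meet-irreducible if it is covered by exactly one element. *)

theory Defs
  imports Main
begin

text \<open>A cell is a pair (row, column label).  Rows are numbered from the top, but columns are
  labelled n, ..., 1 from left to right, so ``to the left'' means a larger label.\<close>

type_synonym cell = "nat \<times> nat"

definition board :: "nat \<Rightarrow> cell set" where
  "board n = {(i, j). i = 1 \<and> 1 \<le> j \<and> j \<le> n} \<union> {(i, j). 2 \<le> i \<and> i \<le> n \<and> i - 1 \<le> j \<and> j \<le> n}"

definition root :: "nat \<Rightarrow> cell" where
  "root n = (1, n)"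

definition border :: "nat \<Rightarrow> cell set" where
  "border n = {(i, i - 1) | i. 2 \<le> i \<and> i \<le> n}"

definition left_of :: "cell \<Rightarrow> cell \<Rightarrow> bool" where
  "left_of c d \<longleftrightarrow> fst c = fst d \<and> snd c > snd d"

definition above :: "cell \<Rightarrow> cell \<Rightarrow> bool" where
  "above c d \<longleftrightarrow> snd c = snd d \<and> fst c < fst d"

text \<open>A filling is represented by its set of nonempty cells.\<close>

definition fb_tableaux :: "nat \<Rightarrow> cell set set" where
  "fb_tableaux n = {T. T \<subseteq> board n \<and> root n \<in> T \<and> border n \<subseteq> T \<and>
     (\<forall>c\<in>T. c \<noteq> root n \<longrightarrow> (\<exists>d\<in>T. left_of d c \<or> above d c))}"

definition left_arrow :: "nat \<Rightarrow> cell set \<Rightarrow> cell \<Rightarrow> bool" where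
  "left_arrow n T c \<longleftrightarrow> c \<in> T \<and> c \<noteq> root n \<and> \<not> (\<exists>d\<in>T. left_of d c)"

definition up_arrow :: "nat \<Rightarrow> cell set \<Rightarrow> cell \<Rightarrow> bool" where
  "up_arrow n T c \<longleftrightarrow> c \<in> T \<and> c \<noteq> root n \<and> \<not> (\<exists>d\<in>T. above d c)"

definition dot :: "nat \<Rightarrow> cell set \<Rightarrow> cell \<Rightarrow> bool" where
  "dot n T c \<longleftrightarrow> c \<in> T \<and> \<not> left_arrow n T c \<and> \<not> up_arrow n T c"

definition free :: "nat \<Rightarrow> cell set \<Rightarrow> cell \<Rightarrow> bool" where
  "free n T c \<longleftrightarrow> c \<in> board n \<and>
     (\<exists>d. up_arrow n T d \<and> above d c) \<and> (\<exists>d. left_arrow n T d \<and> left_of d c)"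

definition Row :: "nat \<Rightarrow> cell set \<Rightarrow> cell set" where
  "Row n T = {c \<in> board n. \<exists>d. (left_arrow n T d \<or> d = root n) \<and> (d = c \<or> left_of d c)}"

definition Col :: "nat \<Rightarrow> cell set \<Rightarrow> cell set" where
  "Col n T = {c \<in> board n. \<exists>d. (up_arrow n T d \<or> d = root n) \<and> (d = c \<or> above d c)}"

definition esTam_le :: "nat \<Rightarrow> cell set \<Rightarrow> cell set \<Rightarrow> bool" where
  "esTam_le n S T \<longleftrightarrow> Col n S \<subseteq> Col n T \<and> Row n T \<subseteq> Row n S \<and>
     (\<forall>c. free n S c \<and> free n T c \<and> dot n S c \<longrightarrow> dot n T c)"

definition esTam_less :: "nat \<Rightarrow> cell set \<Rightarrow> cell set \<Rightarrow> bool" where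
  "esTam_less n S T \<longleftrightarrow> esTam_le n S T \<and> S \<noteq> T"

definition esTam_covered_by :: "nat \<Rightarrow> cell set \<Rightarrow> cell set \<Rightarrow> bool" where
  "esTam_covered_by n S T \<longleftrightarrow> S \<in> fb_tableaux n \<and> T \<in> fb_tableaux n \<and> esTam_less n S T \<and>
     \<not> (\<exists>U\<in>fb_tableaux n. esTam_less n S U \<and> esTam_less n U T)"

definition esTam_meet_irreducible :: "nat \<Rightarrow> cell set \<Rightarrow> bool" where
  "esTam_meet_irreducible n S \<longleftrightarrow> S \<in> fb_tableaux n \<and> (\<exists>!T. esTam_covered_by n S T)"

end

theory Submission imports Defs begin

text \<open>Call a cell inner if it lies neither in row 1 nor in column n.  The order compares, cell by cell
  on the inner cells, whether there is something above, something to the left, and a dot.  Every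
  T above S is above the result of one of three elementary moves on S: lifting an up-arrow, filling
  an empty free cell, deleting a left-arrow.  The results of distinct moves are incomparable, so
  the covers of S are exactly these results, and S is meet-irreducible iff it admits exactly one
  move.  A lift or a deletion can be the unique move at each of the n choose 2 inner cells, a filling
  at each of the (n - 1) choose 2 inner cells off the border, and the move determines S.\<close>

text \<open>The obstacle is that the predicates cannot be changed one cell at a time:
  \<open>hasup\<close> propagates down a column, \<open>hasleft\<close> propagates to the right
  along a row, and every arrow needs support, an up-arrow from a cell to its left, a left-arrow from
  a cell above. Support decides where a lifted up-arrow may stop and to which cell a left-arrow may
  retreat; each move is the smallest change that respects it.

  Having a single move is restrictive for the same reason. A column with label below n whose top
  cell is not in row 1 always admits a lift, so row 1 has at most one gap. A left-arrow off the
  border has a right neighbour on the board, and if something lies above that neighbour, it admits a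
  filling or a deletion. This leaves one row with more than its border cell, and the cell of the
  move sits directly right of the left-arrow of that row.\<close>

section \<open>Predicates on cells\<close>

definition inner :: "nat \<Rightarrow> nat \<Rightarrow> nat \<Rightarrow> bool" where
  "inner n i j \<longleftrightarrow> 2 \<le> i \<and> i \<le> Suc j \<and> j < n"

definition hasup :: "cell set \<Rightarrow> nat \<Rightarrow> nat \<Rightarrow> bool" where
  "hasup S i j \<longleftrightarrow> (\<exists>k<i. (k, j) \<in> S)"

definition hasleft :: "cell set \<Rightarrow> nat \<Rightarrow> nat \<Rightarrow> bool" where
  "hasleft S i j \<longleftrightarrow> (\<exists>k>j. (i, k) \<in> S)"

text \<open>Condition (3) of the order compares dots only on cells free in both tableaux, so it is
  not visibly transitive. Counting a cell with something above and nothing to its left as filled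
  repairs this: when \<open>hasup\<close> grows and \<open>hasleft\<close> shrinks, such a cell
  stays of this kind, and (3) becomes an implication on every inner cell.\<close>

definition filled :: "cell set \<Rightarrow> nat \<Rightarrow> nat \<Rightarrow> bool" where
  "filled S i j \<longleftrightarrow> hasup S i j \<and> (hasleft S i j \<longrightarrow> (i, j) \<in> S)"

lemma board_iff:
  "(i, j) \<in> board n \<longleftrightarrow> (i = 1 \<and> 1 \<le> j \<and> j \<le> n) \<or> (2 \<le> i \<and> i \<le> n \<and> i \<le> Suc j \<and> j \<le> n)"
  by (auto simp: board_def)

lemma border_iff: "(i, j) \<in> border n \<longleftrightarrow> 2 \<le> i \<and> i \<le> n \<and> i = Suc j"
  by (auto simp: border_def)

lemma fb_iff:
  "T \<in> fb_tableaux n \<longleftrightarrow> T \<subseteq> board n \<and> (1, n) \<in> T \<and> (\<forall>j. 1 \<le> j \<and> j < n \<longrightarrow> (Suc j, j) \<in> T) \<and>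
     (\<forall>i j. (i, j) \<in> T \<and> (i, j) \<noteq> (1, n) \<longrightarrow> hasleft T i j \<or> hasup T i j)"
proof -
  have "border n \<subseteq> T \<longleftrightarrow> (\<forall>j. 1 \<le> j \<and> j < n \<longrightarrow> (Suc j, j) \<in> T)"
    by (auto simp: border_iff subset_iff)
  moreover have "(\<exists>d\<in>T. left_of d (i, j) \<or> above d (i, j)) \<longleftrightarrow> hasleft T i j \<or> hasup T i j" for i j
    by (auto simp: left_of_def above_def hasleft_def hasup_def Bex_def)
  ultimately show ?thesis
    unfolding fb_tableaux_def root_def mem_Collect_eq Ball_def split_paired_All by auto
qed

lemma fb_board: "T \<in> fb_tableaux n \<Longrightarrow> (i, j) \<in> T \<Longrightarrow> (i, j) \<in> board n"
  and fb_root: "T \<in> fb_tableaux n \<Longrightarrow> (1, n) \<in> T"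
  and fb_border: "T \<in> fb_tableaux n \<Longrightarrow> 1 \<le> j \<Longrightarrow> j < n \<Longrightarrow> (Suc j, j) \<in> T"
  and fb_arrow: "T \<in> fb_tableaux n \<Longrightarrow> (i, j) \<in> T \<Longrightarrow> (i, j) \<noteq> (1, n) \<Longrightarrow> hasleft T i j \<or> hasup T i j"
  unfolding fb_iff by blast+

lemma hasleft_anti: "hasleft S i j \<Longrightarrow> k \<le> j \<Longrightarrow> hasleft S i k"
  unfolding hasleft_def by (metis le_less_trans)

lemma hasup_mono: "hasup S i j \<Longrightarrow> i \<le> k \<Longrightarrow> hasup S k j"
  unfolding hasup_def by (metis less_le_trans)

lemma hasleft_Suc: "hasleft S i j \<longleftrightarrow> (i, Suc j) \<in> S \<or> hasleft S i (Suc j)"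
  unfolding hasleft_def by (metis Suc_lessD Suc_lessI lessI)

lemma hasup_Suc: "hasup S (Suc i) j \<longleftrightarrow> (i, j) \<in> S \<or> hasup S i j"
  unfolding hasup_def by (auto simp: less_Suc_eq)

text \<open>Labels grow to the left, so the leftmost cell is a maximum and the bound given by the
  board is what makes it exist; \<open>topmost\<close> is a minimum of natural numbers.\<close>

lemma leftmost:
  assumes "T \<in> fb_tableaux n" "(i, j) \<in> T"
  obtains k where "j \<le> k" "(i, k) \<in> T" "\<not> hasleft T i k"
proof -
  let ?K = "{k. (i, k) \<in> T}"
  have "?K \<subseteq> {..n}" using fb_board[OF assms(1)] by (auto simp: board_iff)
  then have fin: "finite ?K" by (rule finite_subset) simp
  show thesis
  proof (rule that)
    show "j \<le> Max ?K" using fin assms(2) by simp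
    have "Max ?K \<in> ?K" using fin assms(2) by (intro Max_in) auto
    then show "(i, Max ?K) \<in> T" by simp
    show "\<not> hasleft T i (Max ?K)" unfolding hasleft_def
      using Max_ge[OF fin] by (auto simp: not_less)
  qed
qed

lemma topmost:
  assumes "(i, j) \<in> T"
  obtains k where "k \<le> i" "(k, j) \<in> T" "\<not> hasup T k j"
proof
  show "(LEAST k. (k, j) \<in> T) \<le> i" using assms by (rule Least_le)
  show "((LEAST k. (k, j) \<in> T), j) \<in> T" using assms by (rule LeastI)
  show "\<not> hasup T (LEAST k. (k, j) \<in> T) j" unfolding hasup_def using not_less_Least by blast
qed

lemma left_arrow_iff: "left_arrow n T (i, j) \<longleftrightarrow> (i, j) \<in> T \<and> (i, j) \<noteq> (1, n) \<and> \<not> hasleft T i j"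
  by (auto simp: left_arrow_def root_def left_of_def hasleft_def)

lemma up_arrow_iff: "up_arrow n T (i, j) \<longleftrightarrow> (i, j) \<in> T \<and> (i, j) \<noteq> (1, n) \<and> \<not> hasup T i j"
  by (auto simp: up_arrow_def root_def above_def hasup_def)

text \<open>The leftmost cell of a row is its left-arrow, except in row 1, where it is the root and
  hence a dot.\<close>

lemma hasleft_iff_left_arrow:
  assumes "T \<in> fb_tableaux n" "i \<noteq> 1"
  shows "hasleft T i j \<longleftrightarrow> (\<exists>d. left_arrow n T d \<and> left_of d (i, j))"
proof
  assume "hasleft T i j"
  then obtain k where "j < k" "(i, k) \<in> T" unfolding hasleft_def by blast
  moreover from this(2) obtain m where "k \<le> m" "(i, m) \<in> T" "\<not> hasleft T i m"
    using leftmost[OF assms(1)] by blast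
  ultimately have "left_arrow n T (i, m) \<and> left_of (i, m) (i, j)"
    using assms(2) by (auto simp: left_arrow_iff left_of_def)
  then show "\<exists>d. left_arrow n T d \<and> left_of d (i, j)" by blast
next
  assume "\<exists>d. left_arrow n T d \<and> left_of d (i, j)"
  then show "hasleft T i j" by (auto simp: left_arrow_iff left_of_def hasleft_def)
qed

lemma hasup_iff_up_arrow:
  assumes "j \<noteq> n"
  shows "hasup T i j \<longleftrightarrow> (\<exists>d. up_arrow n T d \<and> above d (i, j))"
proof
  assume "hasup T i j"
  then obtain k where "k < i" "(k, j) \<in> T" unfolding hasup_def by blast
  moreover from this(2) obtain m where "m \<le> k" "(m, j) \<in> T" "\<not> hasup T m j"
    using topmost by blast
  ultimately have "up_arrow n T (m, j) \<and> above (m, j) (i, j)"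
    using assms by (auto simp: up_arrow_iff above_def)
  then show "\<exists>d. up_arrow n T d \<and> above d (i, j)" by blast
next
  assume "\<exists>d. up_arrow n T d \<and> above d (i, j)"
  then show "hasup T i j" by (auto simp: up_arrow_iff above_def hasup_def)
qed

section \<open>The order in terms of the cell predicates\<close>

lemma Row_iff:
  assumes "T \<in> fb_tableaux n"
  shows "(i, j) \<in> Row n T \<longleftrightarrow> (i, j) \<in> board n \<and> (i = 1 \<or> (i, j) \<in> T \<or> hasleft T i j)"
proof (cases "i = 1")
  case True
  have "(i, j) \<in> Row n T" if "(i, j) \<in> board n"
    unfolding Row_def using that True
    by (intro CollectI conjI exI[of _ "root n"]) (auto simp: root_def left_of_def board_iff)
  with True show ?thesis by (auto simp: Row_def)
next
  case False
  have "(i, j) \<in> Row n T \<longleftrightarrow> (i, j) \<in> board n \<and>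
     (left_arrow n T (i, j) \<or> (\<exists>d. left_arrow n T d \<and> left_of d (i, j)))"
    using False by (auto simp: Row_def root_def left_of_def)
  with False show ?thesis
    unfolding hasleft_iff_left_arrow[OF assms False, symmetric] left_arrow_iff by auto
qed

lemma Col_iff:
  "(i, j) \<in> Col n T \<longleftrightarrow> (i, j) \<in> board n \<and> (j = n \<or> (i, j) \<in> T \<or> hasup T i j)"
proof (cases "j = n")
  case True
  have "(i, j) \<in> Col n T" if "(i, j) \<in> board n"
    unfolding Col_def using that True
    by (intro CollectI conjI exI[of _ "root n"]) (auto simp: root_def above_def board_iff)
  with True show ?thesis by (auto simp: Col_def)
next
  case False
  have "(i, j) \<in> Col n T \<longleftrightarrow> (i, j) \<in> board n \<and>
     (up_arrow n T (i, j) \<or> (\<exists>d. up_arrow n T d \<and> above d (i, j)))"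
    using False by (auto simp: Col_def root_def above_def)
  with False show ?thesis
    unfolding hasup_iff_up_arrow[OF False, symmetric] up_arrow_iff by auto
qed

lemma hasup_inner:
  assumes "T \<in> fb_tableaux n" "hasup T i j"
  shows "2 \<le> i"
proof -
  obtain k where k: "k < i" "(k, j) \<in> T" using assms(2) by (auto simp: hasup_def)
  then show ?thesis using fb_board[OF assms(1) k(2)] by (auto simp: board_iff)
qed

lemma hasleft_less:
  assumes "T \<in> fb_tableaux n" "hasleft T i j"
  shows "j < n" "1 \<le> i" "i \<le> n"
proof -
  obtain k where k: "j < k" "(i, k) \<in> T" using assms(2) by (auto simp: hasleft_def)
  then show "j < n" "1 \<le> i" "i \<le> n" using fb_board[OF assms(1) k(2)] by (auto simp: board_iff)
qed

lemma hasup_last_column: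
  assumes "T \<in> fb_tableaux n" "2 \<le> i"
  shows "hasup T i n"
  unfolding hasup_def using fb_root[OF assms(1)] assms(2) by (intro exI[of _ 1]) simp

lemma free_iff:
  assumes "T \<in> fb_tableaux n"
  shows "free n T (i, j) \<longleftrightarrow> inner n i j \<and> hasup T i j \<and> hasleft T i j"
proof (cases "inner n i j")
  case True
  then have "i \<noteq> 1" "j \<noteq> n" by (auto simp: inner_def)
  with True show ?thesis
    unfolding free_def hasleft_iff_left_arrow[OF assms \<open>i \<noteq> 1\<close>] hasup_iff_up_arrow[OF \<open>j \<noteq> n\<close>]
    by (auto simp: inner_def board_iff)
next
  case False
  have "\<not> free n T (i, j)"
  proof
    assume f: "free n T (i, j)"
    then have "hasup T i j" "hasleft T i j" "(i, j) \<in> board n"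
      by (auto simp: free_def hasup_def hasleft_def left_of_def above_def left_arrow_def up_arrow_def)
    with False show False
      using hasup_inner[OF assms] hasleft_less[OF assms] by (auto simp: inner_def board_iff)
  qed
  with False show ?thesis by simp
qed

lemma dot_iff:
  assumes "inner n i j"
  shows "dot n T (i, j) \<longleftrightarrow> (i, j) \<in> T \<and> hasup T i j \<and> hasleft T i j"
  using assms by (auto simp: dot_def left_arrow_iff up_arrow_iff inner_def)

text \<open>Outside column n, membership in \<open>Col\<close> is \<open>hasup\<close> one row
  further down. The shift misses only border cells, which have no board cell below them but are
  nonempty and so always lie in \<open>Col\<close>.\<close>

lemma Col_subset_iff:
  assumes S: "S \<in> fb_tableaux n" and T: "T \<in> fb_tableaux n"
  shows "Col n S \<subseteq> Col n T \<longleftrightarrow> (\<forall>i j. inner n i j \<and> hasup S i j \<longrightarrow> hasup T i j)"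
proof
  assume L: "Col n S \<subseteq> Col n T"
  show "\<forall>i j. inner n i j \<and> hasup S i j \<longrightarrow> hasup T i j"
  proof (intro allI impI, elim conjE)
    fix i j assume in_: "inner n i j" and up: "hasup S i j"
    then obtain k where k: "k < i" "(k, j) \<in> S" by (auto simp: hasup_def)
    then have "(k, j) \<in> Col n S" using fb_board[OF S] by (simp add: Col_iff)
    then have "(k, j) \<in> Col n T" using L by blast
    then have "hasup T (Suc k) j" using in_ by (auto simp: Col_iff hasup_Suc inner_def)
    then show "hasup T i j" using k(1) hasup_mono by (metis Suc_leI)
  qed
next
  assume R: "\<forall>i j. inner n i j \<and> hasup S i j \<longrightarrow> hasup T i j"
  show "Col n S \<subseteq> Col n T"
  proof (rule subrelI)
    fix i j assume c: "(i, j) \<in> Col n S"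
    then have b: "(i, j) \<in> board n" by (simp add: Col_iff)
    have "j = n \<or> (j < n \<and> i = Suc j) \<or> inner n (Suc i) j"
      using b unfolding board_iff inner_def by arith
    then consider "j = n" | "j < n" "i = Suc j" | "inner n (Suc i) j" by blast
    then show "(i, j) \<in> Col n T"
    proof cases
      case 1 then show ?thesis using b by (simp add: Col_iff)
    next
      case 2 then show ?thesis using b fb_border[OF T, of j] by (auto simp: Col_iff board_iff)
    next
      case 3
      then have "hasup S (Suc i) j" using c by (auto simp: Col_iff hasup_Suc inner_def)
      then have "hasup T (Suc i) j" using 3 R by blast
      then show ?thesis using b by (auto simp: Col_iff hasup_Suc)
    qed
  qed
qed

text \<open>Mirror image: below row 1, membership in \<open>Row\<close> is \<open>hasleft\<close>
  one cell further right, and again only border cells lack that neighbour.\<close>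

lemma Row_subset_iff:
  assumes S: "S \<in> fb_tableaux n" and T: "T \<in> fb_tableaux n"
  shows "Row n S \<subseteq> Row n T \<longleftrightarrow> (\<forall>i j. inner n i j \<and> hasleft S i j \<longrightarrow> hasleft T i j)"
proof
  assume L: "Row n S \<subseteq> Row n T"
  show "\<forall>i j. inner n i j \<and> hasleft S i j \<longrightarrow> hasleft T i j"
  proof (intro allI impI, elim conjE)
    fix i j assume in_: "inner n i j" and up: "hasleft S i j"
    then obtain k where k: "j < k" "(i, k) \<in> S" by (auto simp: hasleft_def)
    then have "(i, k) \<in> Row n S" using fb_board[OF S] by (simp add: Row_iff[OF S])
    then have "(i, k) \<in> Row n T" using L by blast
    then have "(i, k) \<in> T \<or> hasleft T i k" using in_ by (auto simp: Row_iff[OF T] inner_def)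
    then show "hasleft T i j" using k(1) unfolding hasleft_def by (metis less_trans)
  qed
next
  assume R: "\<forall>i j. inner n i j \<and> hasleft S i j \<longrightarrow> hasleft T i j"
  show "Row n S \<subseteq> Row n T"
  proof (rule subrelI)
    fix i j assume c: "(i, j) \<in> Row n S"
    then have b: "(i, j) \<in> board n" by (simp add: Row_iff[OF S])
    have "i = 1 \<or> (j < n \<and> 1 \<le> j \<and> i = Suc j) \<or> (j = Suc (j - 1) \<and> inner n i (j - 1))"
      using b unfolding board_iff inner_def by arith
    then consider "i = 1" | "j < n" "1 \<le> j" "i = Suc j" | k where "j = Suc k" "inner n i k" by blast
    then show "(i, j) \<in> Row n T"
    proof cases
      case 1 then show ?thesis using b by (simp add: Row_iff[OF T])
    next
      case 2 then show ?thesis using b fb_border[OF T, of j] by (auto simp: Row_iff[OF T])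
    next
      case 3
      then have "hasleft S i k" using c hasleft_Suc[of S i k] by (auto simp: Row_iff[OF S] inner_def)
      then show ?thesis using 3 R b hasleft_Suc[of T i k] by (auto simp: Row_iff[OF T])
    qed
  qed
qed

text \<open>On a single inner cell the three predicates take five combinations of values, ordered as
  the pentagon lattice; on a border cell only a three-element chain remains.\<close>

lemma esTam_le_iff:
  assumes S: "S \<in> fb_tableaux n" and T: "T \<in> fb_tableaux n"
  shows "esTam_le n S T \<longleftrightarrow> (\<forall>i j. inner n i j \<longrightarrow>
     (hasup S i j \<longrightarrow> hasup T i j) \<and> (hasleft T i j \<longrightarrow> hasleft S i j) \<and> (filled S i j \<longrightarrow> filled T i j))"
proof -
  have "esTam_le n S T \<longleftrightarrow> Col n S \<subseteq> Col n T \<and> Row n T \<subseteq> Row n S \<and>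
     (\<forall>i j. free n S (i, j) \<and> free n T (i, j) \<and> dot n S (i, j) \<longrightarrow> dot n T (i, j))"
    by (auto simp: esTam_le_def)
  then show ?thesis
    unfolding Col_subset_iff[OF S T] Row_subset_iff[OF T S] free_iff[OF S] free_iff[OF T] filled_def
    by (auto simp: dot_iff)
qed

lemma esTam_le_refl: "S \<in> fb_tableaux n \<Longrightarrow> esTam_le n S S"
  by (simp add: esTam_le_iff)

lemma esTam_le_trans:
  assumes "S \<in> fb_tableaux n" "T \<in> fb_tableaux n" "U \<in> fb_tableaux n"
    "esTam_le n S T" "esTam_le n T U"
  shows "esTam_le n S U"
  using assms(4,5)
  unfolding esTam_le_iff[OF assms(1,2)] esTam_le_iff[OF assms(2,3)] esTam_le_iff[OF assms(1,3)]
  by blast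

text \<open>Row 1 is read off \<open>hasup\<close> in row 2, and column n off \<open>hasleft\<close>
  in column n - 1. A nonempty inner cell of \<open>S\<close> off the border is seen by its lower and
  its right neighbour. If it were empty in \<open>T\<close>, the witnesses for these neighbours in
  \<open>T\<close> would lie beyond it, making it free and empty in \<open>T\<close> although
  \<open>filled\<close>.\<close>

lemma fb_subset_if_agree:
  assumes S: "S \<in> fb_tableaux n" and T: "T \<in> fb_tableaux n"
    and up: "\<And>i j. inner n i j \<Longrightarrow> hasup S i j \<longleftrightarrow> hasup T i j"
    and left: "\<And>i j. inner n i j \<Longrightarrow> hasleft S i j \<longleftrightarrow> hasleft T i j"
    and fill: "\<And>i j. inner n i j \<Longrightarrow> filled S i j \<longleftrightarrow> filled T i j"
  shows "S \<subseteq> T"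
proof (rule subrelI)
  fix i j assume c: "(i, j) \<in> S"
  note b = fb_board[OF S c]
  have "i = 1 \<and> j = n \<or> 1 \<le> j \<and> j < n \<and> i = Suc j \<or> i = 1 \<and> 1 \<le> j \<and> j < n \<or>
      2 \<le> i \<and> i \<le> n \<and> j = n \<or> 2 \<le> i \<and> i \<le> j \<and> j < n"
    using b unfolding board_iff by linarith
  then consider "i = 1" "j = n" | "1 \<le> j" "j < n" "i = Suc j" | "i = 1" "inner n 2 j"
    | "2 \<le> i" "j = n" "inner n i (n - 1)"
    | "inner n i j" "inner n (Suc i) j" "inner n i (j - 1)" "i \<le> j"
    by (elim disjE) (auto simp: inner_def)
  then show "(i, j) \<in> T"
  proof cases
    case 1 then show ?thesis using fb_root[OF T] by simp
  next
    case 2 then show ?thesis using fb_border[OF T] by simp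
  next
    case 3
    have "hasup S 2 j" using c 3 unfolding hasup_def by (intro exI[of _ 1]) simp
    then have "hasup T 2 j" using up 3 by simp
    then obtain k where k: "k < 2" "(k, j) \<in> T" by (auto simp: hasup_def)
    then have "k = 1" using fb_board[OF T k(2)] by (auto simp: board_iff)
    then show ?thesis using 3 k by simp
  next
    case 4
    then have "hasleft S i (n - 1)" using c unfolding hasleft_def by (auto simp: inner_def)
    then have "hasleft T i (n - 1)" using left 4 by simp
    then obtain k where k: "k > n - 1" "(i, k) \<in> T" by (auto simp: hasleft_def)
    then have "k = n" using fb_board[OF T k(2)] by (auto simp: board_iff)
    then show ?thesis using 4 k by simp
  next
    case 5
    show ?thesis
    proof (rule ccontr)
      assume n: "(i, j) \<notin> T"
      have "hasup S (Suc i) j" using c by (simp add: hasup_Suc)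
      then have "hasup T (Suc i) j" using up 5 by simp
      then have 1: "hasup T i j" using n by (simp add: hasup_Suc)
      obtain k where k: "j = Suc k" using 5 by (cases j) (auto simp: inner_def)
      have "hasleft S i (j - 1)" using c hasleft_Suc[of S i k] unfolding k by simp
      then have "hasleft T i (j - 1)" using left 5 by simp
      then have 2: "hasleft T i j" using n unfolding k hasleft_Suc[of T i k] diff_Suc_1 by blast
      have "filled S i j" using 1 up 5 c by (simp add: filled_def)
      then have "filled T i j" using fill 5 by simp
      then show False using 1 2 n by (simp add: filled_def)
    qed
  qed
qed

lemma esTam_le_antisym:
  assumes "S \<in> fb_tableaux n" "T \<in> fb_tableaux n" "esTam_le n S T" "esTam_le n T S"
  shows "S = T"
  using assms esTam_le_iff[OF assms(1,2)] esTam_le_iff[OF assms(2,1)]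
  by (intro equalityI fb_subset_if_agree[of _ n]) blast+


section \<open>The elementary moves\<close>

text \<open>Up i j lifts the up-arrow at (i, j) to the nearest row above where a cell to its left is
  nonempty (or to row 1), Fill i j puts a dot into the free cell (i, j), and Cut i j deletes the
  left-arrow of row i, so that the dot at (i, j), named here instead of the arrow, becomes the new
  left-arrow.\<close>

datatype move = Up nat nat | Fill nat nat | Cut nat nat

text \<open>The last condition on \<open>Cut\<close> concerns the cells strictly between the
  left-arrow and (i, j). One with something above would be an earlier stop if nonempty, or a free
  cell to be filled first if empty; an up-arrow there would be left with neither a cell above nor a
  cell to its left.\<close>

fun enabled :: "nat \<Rightarrow> cell set \<Rightarrow> move \<Rightarrow> bool" where
  "enabled n S (Up i j) \<longleftrightarrow> (i, j) \<in> S \<and> 2 \<le> i \<and> \<not> hasup S i j"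
| "enabled n S (Fill i j) \<longleftrightarrow> inner n i j \<and> hasup S i j \<and> hasleft S i j \<and> (i, j) \<notin> S"
| "enabled n S (Cut i j) \<longleftrightarrow> (i, j) \<in> S \<and> hasup S i j \<and> hasleft S i j \<and>
     (\<forall>m>j. hasleft S i m \<longrightarrow> \<not> hasup S i m \<and> (i, m) \<notin> S)"

text \<open>A cell with nothing above needs a cell to its left, so only such rows can receive the
  lifted arrow. Row 1 always qualifies because of the root, which keeps the set nonempty for i at
  least 2.\<close>

definition landing :: "cell set \<Rightarrow> nat \<Rightarrow> nat \<Rightarrow> nat" where
  "landing S i j = Max {p. p < i \<and> (p = 1 \<or> hasleft S p j)}"

text \<open>Border cells must stay nonempty, so a lift leaves a dot behind on the border and an
  empty free cell elsewhere. By the gap condition in \<open>enabled\<close>, a cut removes the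
  left-arrow alone.\<close>

fun result :: "nat \<Rightarrow> cell set \<Rightarrow> move \<Rightarrow> cell set" where
  "result n S (Up i j) = insert (landing S i j, j) (S - ({(i, j)} - border n))"
| "result n S (Fill i j) = insert (i, j) S"
| "result n S (Cut i j) = {(a, b) \<in> S. a = i \<longrightarrow> b \<le> j}"

lemma landing:
  assumes "S \<in> fb_tableaux n" "2 \<le> i"
  shows "landing S i j < i" "1 \<le> landing S i j" "landing S i j = 1 \<or> hasleft S (landing S i j) j"
    "landing S i j < q \<Longrightarrow> q < i \<Longrightarrow> \<not> hasleft S q j"
proof -
  let ?P = "{p. p < i \<and> (p = 1 \<or> hasleft S p j)}"
  have fin: "finite ?P" by simp
  have "1 \<in> ?P" using assms(2) by simp
  then have "landing S i j \<in> ?P" unfolding landing_def using fin by (intro Max_in) auto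
  then show "landing S i j < i" "landing S i j = 1 \<or> hasleft S (landing S i j) j" by auto
  show "1 \<le> landing S i j" unfolding landing_def using fin \<open>1 \<in> ?P\<close> by (rule Max_ge)
  assume q: "landing S i j < q" "q < i"
  show "\<not> hasleft S q j"
  proof
    assume "hasleft S q j"
    then have "q \<in> ?P" using q by simp
    then have "q \<le> landing S i j" unfolding landing_def by (rule Max_ge[OF fin])
    then show False using q by simp
  qed
qed

lemma inner_board: "inner n i j \<Longrightarrow> (i, j) \<in> board n"
  by (auto simp: inner_def board_iff)

lemma board_inner: "(i, j) \<in> board n \<Longrightarrow> 2 \<le> i \<Longrightarrow> j < n \<Longrightarrow> inner n i j"
  by (auto simp: inner_def board_iff)

lemma enabled_inner:
  assumes S: "S \<in> fb_tableaux n"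
  shows "enabled n S (Up i j) \<Longrightarrow> inner n i j"
    and "enabled n S (Fill i j) \<Longrightarrow> inner n i j"
    and "enabled n S (Cut i j) \<Longrightarrow> inner n i j"
proof -
  assume e: "enabled n S (Up i j)"
  then have "j \<noteq> n" using hasup_last_column[OF S] by auto
  moreover have "(i, j) \<in> board n" using e fb_board[OF S] by simp
  ultimately show "inner n i j" using e by (auto simp: inner_def board_iff)
next
  assume e: "enabled n S (Cut i j)"
  then show "inner n i j"
    using board_inner[OF fb_board[OF S, of i j] hasup_inner[OF S, of i j] hasleft_less(1)[OF S, of i j]]
    by simp
qed simp

text \<open>Rows strictly between p and i have nothing to the left of column j, so their cells in
  that column become filled merely by gaining something above. The vacated cell is free, hence
  filled only on the border. \<open>hasleft\<close> is undisturbed because the old arrow has a cell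
  further left, and so has the new one if it is below row 1.\<close>

lemma result_Up:
  assumes S: "S \<in> fb_tableaux n" and e: "enabled n S (Up i j)"
  defines "R \<equiv> result n S (Up i j)" and "p \<equiv> landing S i j"
  shows "R \<in> fb_tableaux n"
    and "hasup R a b \<longleftrightarrow> hasup S a b \<or> (b = j \<and> p < a)"
    and "a \<noteq> 1 \<Longrightarrow> hasleft R a b \<longleftrightarrow> hasleft S a b"
    and "inner n a b \<Longrightarrow>
      filled R a b \<longleftrightarrow> filled S a b \<or> (b = j \<and> p < a \<and> (a < i \<or> a = i \<and> i = Suc j))"
proof -
  have ij: "(i, j) \<in> S" "2 \<le> i" "\<not> hasup S i j" using e by auto
  have in_: "inner n i j" using enabled_inner(1)[OF S e] .
  have left: "hasleft S i j" using fb_arrow[OF S ij(1)] ij by auto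
  note p = landing[OF S ij(2), of j, folded p_def]
  have mem: "(a, b) \<in> R \<longleftrightarrow> (a = p \<and> b = j) \<or> ((a, b) \<in> S \<and> \<not> (a = i \<and> b = j \<and> i \<noteq> Suc j))" for a b
    using in_ by (auto simp: R_def p_def border_iff inner_def)
  show up: "hasup R a b \<longleftrightarrow> hasup S a b \<or> (b = j \<and> p < a)" for a b
  proof
    assume "hasup R a b"
    then show "hasup S a b \<or> (b = j \<and> p < a)" by (auto simp: hasup_def mem)
  next
    assume "hasup S a b \<or> (b = j \<and> p < a)"
    then consider "b = j \<and> p < a" | k where "k < a" "(k, b) \<in> S" by (auto simp: hasup_def)
    then show "hasup R a b"
    proof cases
      case 1 then show ?thesis by (auto simp: hasup_def mem)
    next
      case 2
      show ?thesis
      proof (cases "k = i \<and> b = j")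
        case True then show ?thesis using 2 p(1) unfolding hasup_def mem by (intro exI[of _ p]) auto
      next
        case False then show ?thesis using 2 unfolding hasup_def mem by (intro exI[of _ k]) auto
      qed
    qed
  qed
  show lft: "hasleft R a b \<longleftrightarrow> hasleft S a b" if a: "a \<noteq> 1" for a b
  proof
    assume "hasleft R a b"
    then obtain k where k: "b < k" "(a, k) \<in> R" by (auto simp: hasleft_def)
    show "hasleft S a b"
    proof (cases "a = p \<and> k = j")
      case True then show ?thesis using p(3) a k(1) hasleft_anti[of S a j b] by auto
    next
      case False then show ?thesis using k by (auto simp: mem hasleft_def)
    qed
  next
    assume "hasleft S a b"
    then obtain k where k: "b < k" "(a, k) \<in> S" by (auto simp: hasleft_def)
    show "hasleft R a b"
    proof (cases "a = i \<and> k = j")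
      case True
      obtain m where "j < m" "(i, m) \<in> S" using left by (auto simp: hasleft_def)
      then show ?thesis using True k unfolding hasleft_def mem by (intro exI[of _ m]) auto
    next
      case False then show ?thesis using k by (auto simp: mem hasleft_def)
    qed
  qed
  have root: "(1, n) \<in> R" using fb_root[OF S] ij(2) by (auto simp: mem)
  show "R \<in> fb_tableaux n"
    unfolding fb_iff
  proof (intro conjI allI impI subrelI)
    fix a b assume "(a, b) \<in> R"
    then consider "a = p" "b = j" | "(a, b) \<in> S" by (auto simp: mem)
    then show "(a, b) \<in> board n"
    proof cases
      case 1 then show ?thesis using p(1,2) in_ by (auto simp: board_iff inner_def)
    next
      case 2 then show ?thesis by (rule fb_board[OF S])
    qed
  next
    show "(1, n) \<in> R" by (rule root)
  next
    fix b assume "1 \<le> b \<and> b < n"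
    then show "(Suc b, b) \<in> R" using fb_border[OF S] by (auto simp: mem)
  next
    fix a b assume ab: "(a, b) \<in> R \<and> (a, b) \<noteq> (1, n)"
    show "hasleft R a b \<or> hasup R a b"
    proof (cases "a = 1")
      case True
      have "b \<le> n" using ab fb_board[OF S] in_ by (auto simp: mem board_iff inner_def)
      then have "b < n" using ab True by auto
      then show ?thesis using root True by (auto simp: hasleft_def)
    next
      case False
      have "hasleft S a b \<or> hasup S a b"
        using ab False p(3) fb_arrow[OF S] by (auto simp: mem)
      then show ?thesis using lft[OF False] up by blast
    qed
  qed
  assume inn: "inner n a b"
  then have a1: "a \<noteq> 1" by (auto simp: inner_def)
  show "filled R a b \<longleftrightarrow> filled S a b \<or> (b = j \<and> p < a \<and> (a < i \<or> a = i \<and> i = Suc j))"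
  proof (cases "b = j")
    case False
    then show ?thesis by (auto simp: filled_def up lft[OF a1] mem)
  next
    case b: True
    consider "a \<le> p" | "p < a" "a < i" | "a = i" | "i < a" using p(1) by linarith
    then show ?thesis
    proof cases
      case 1
      then have "\<not> hasup S a j" using ij(3) hasup_mono[of S a j i] p(1) by auto
      then show ?thesis using b 1 by (auto simp: filled_def up)
    next
      case 2
      then show ?thesis using b p(4) by (auto simp: filled_def up lft[OF a1])
    next
      case 3
      have "hasleft R i j" using lft[of i j] ij(2) left by simp
      then show ?thesis using b 3 p(1) ij by (auto simp: filled_def up mem)
    next
      case 4
      then have "hasup S a j" using ij(1) by (auto simp: hasup_def)
      then show ?thesis using b 4 p(1) by (auto simp: filled_def up lft[OF a1] mem)
    qed
  qed
qed

text \<open>The new cell already has witnesses above and to its left, and these also serve every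
  cell below it or to its right.\<close>

lemma result_Fill:
  assumes S: "S \<in> fb_tableaux n" and e: "enabled n S (Fill i j)"
  defines "R \<equiv> result n S (Fill i j)"
  shows "R \<in> fb_tableaux n"
    and "hasup R a b \<longleftrightarrow> hasup S a b"
    and "hasleft R a b \<longleftrightarrow> hasleft S a b"
    and "filled R a b \<longleftrightarrow> filled S a b \<or> (a = i \<and> b = j)"
proof -
  have ij: "inner n i j" "hasup S i j" "hasleft S i j" using e by auto
  have mem: "(a, b) \<in> R \<longleftrightarrow> (a = i \<and> b = j) \<or> (a, b) \<in> S" for a b by (auto simp: R_def)
  show up: "hasup R a b \<longleftrightarrow> hasup S a b" for a b
    using hasup_mono[OF ij(2)] by (auto simp: hasup_def mem)
  show lft: "hasleft R a b \<longleftrightarrow> hasleft S a b" for a b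
    using hasleft_anti[OF ij(3)] by (auto simp: hasleft_def mem)
  show "filled R a b \<longleftrightarrow> filled S a b \<or> (a = i \<and> b = j)"
    using ij by (auto simp: filled_def up lft mem)
  show "R \<in> fb_tableaux n"
    using S inner_board[OF ij(1)] ij(2) unfolding fb_iff up lft mem by (auto simp: R_def)
qed

text \<open>The deleted left-arrow has something above it, which takes over as witness for the cells
  below. \<open>filled\<close> survives because a cell losing \<open>hasleft\<close> either has
  nothing above or is the nonempty cell (i, j).\<close>

lemma result_Cut:
  assumes S: "S \<in> fb_tableaux n" and e: "enabled n S (Cut i j)"
  defines "R \<equiv> result n S (Cut i j)"
  shows "R \<in> fb_tableaux n"
    and "hasup R a b \<longleftrightarrow> hasup S a b"
    and "hasleft R a b \<longleftrightarrow> hasleft S a b \<and> \<not> (a = i \<and> j \<le> b)"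
    and "filled R a b \<longleftrightarrow> filled S a b"
proof -
  have ij: "(i, j) \<in> S" "hasup S i j" "hasleft S i j"
    and gap: "\<And>m. j < m \<Longrightarrow> hasleft S i m \<Longrightarrow> \<not> hasup S i m \<and> (i, m) \<notin> S" using e by auto
  have in_: "inner n i j" by (rule enabled_inner(3)[OF S e])
  have mem: "(a, b) \<in> R \<longleftrightarrow> (a, b) \<in> S \<and> (a = i \<longrightarrow> b \<le> j)" for a b by (auto simp: R_def)
  show up: "hasup R a b \<longleftrightarrow> hasup S a b" for a b
  proof
    assume "hasup R a b" then show "hasup S a b" by (auto simp: hasup_def mem)
  next
    assume "hasup S a b"
    then obtain k where k: "k < a" "(k, b) \<in> S" by (auto simp: hasup_def)
    show "hasup R a b"
    proof (cases "k = i \<and> j < b")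
      case True
      then have "\<not> hasleft S i b" using gap k(2) by blast
      moreover have "(i, b) \<noteq> (1, n)" using in_ by (auto simp: inner_def)
      ultimately have "hasup S i b" using fb_arrow[OF S, of i b] k(2) True by blast
      then obtain m where "m < i" "(m, b) \<in> S" by (auto simp: hasup_def)
      then show ?thesis using True k(1) unfolding hasup_def mem by (intro exI[of _ m]) auto
    next
      case False then show ?thesis using k unfolding hasup_def mem by (intro exI[of _ k]) auto
    qed
  qed
  show lft: "hasleft R a b \<longleftrightarrow> hasleft S a b \<and> \<not> (a = i \<and> j \<le> b)" for a b
  proof
    assume "hasleft R a b"
    then show "hasleft S a b \<and> \<not> (a = i \<and> j \<le> b)" by (auto simp: hasleft_def mem)
  next
    assume h: "hasleft S a b \<and> \<not> (a = i \<and> j \<le> b)"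
    show "hasleft R a b"
    proof (cases "a = i")
      case True then show ?thesis using h ij(1) unfolding hasleft_def mem by (intro exI[of _ j]) auto
    next
      case False then show ?thesis using h by (auto simp: hasleft_def mem)
    qed
  qed
  show "filled R a b \<longleftrightarrow> filled S a b"
  proof (cases "a = i \<and> j \<le> b")
    case True
    then consider "b = j" | "j < b" by linarith
    then show ?thesis using True ij gap by cases (auto simp: filled_def up lft)
  next
    case False then show ?thesis by (auto simp: filled_def up lft mem)
  qed
  show "R \<in> fb_tableaux n"
    unfolding fb_iff
  proof (intro conjI allI impI subrelI)
    fix a b assume "(a, b) \<in> R" then show "(a, b) \<in> board n" using fb_board[OF S] by (auto simp: mem)
  next
    show "(1, n) \<in> R" using fb_root[OF S] in_ by (auto simp: mem inner_def)
  next
    fix b assume "1 \<le> b \<and> b < n"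
    then show "(Suc b, b) \<in> R" using fb_border[OF S] in_ by (auto simp: mem inner_def)
  next
    fix a b assume ab: "(a, b) \<in> R \<and> (a, b) \<noteq> (1, n)"
    then have "hasleft S a b \<or> hasup S a b" using fb_arrow[OF S] by (auto simp: mem)
    moreover have "hasup S a b" if "a = i" "b = j" using that ij by simp
    moreover have "\<not> (a = i \<and> j < b)" using ab by (auto simp: mem)
    ultimately show "hasleft R a b \<or> hasup R a b" unfolding up lft by force
  qed
qed

lemma result_fb:
  assumes "S \<in> fb_tableaux n" "enabled n S l"
  shows "result n S l \<in> fb_tableaux n"
  using assms result_Up(1) result_Fill(1) result_Cut(1) by (cases l) blast+

lemma less_result:
  assumes S: "S \<in> fb_tableaux n" and e: "enabled n S l"
  shows "esTam_less n S (result n S l)"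
proof -
  have "esTam_le n S (result n S l)"
    unfolding esTam_le_iff[OF S result_fb[OF S e]]
  proof (cases l)
    case (Up i j)
    have "a \<noteq> 1" if "inner n a b" for a b using that by (auto simp: inner_def)
    then show "\<forall>i j. inner n i j \<longrightarrow> (hasup S i j \<longrightarrow> hasup (result n S l) i j) \<and>
      (hasleft (result n S l) i j \<longrightarrow> hasleft S i j) \<and> (filled S i j \<longrightarrow> filled (result n S l) i j)"
      using result_Up[OF S e[unfolded Up]] unfolding Up by blast
  next
    case (Fill i j)
    then show "\<forall>i j. inner n i j \<longrightarrow> (hasup S i j \<longrightarrow> hasup (result n S l) i j) \<and>
      (hasleft (result n S l) i j \<longrightarrow> hasleft S i j) \<and> (filled S i j \<longrightarrow> filled (result n S l) i j)"
      using result_Fill[OF S e[unfolded Fill]] by blast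
  next
    case (Cut i j)
    then show "\<forall>i j. inner n i j \<longrightarrow> (hasup S i j \<longrightarrow> hasup (result n S l) i j) \<and>
      (hasleft (result n S l) i j \<longrightarrow> hasleft S i j) \<and> (filled S i j \<longrightarrow> filled (result n S l) i j)"
      using result_Cut[OF S e[unfolded Cut]] by blast
  qed
  moreover have "S \<noteq> result n S l"
  proof (cases l)
    case (Up i j)
    then have "\<not> hasup S i j" "2 \<le> i" using e by auto
    then show ?thesis using result_Up(2)[OF S e[unfolded Up], of i j] landing(1)[OF S, of i j] Up by auto
  next
    case (Fill i j)
    then show ?thesis using e by auto
  next
    case (Cut i j)
    then show ?thesis using e result_Cut(3)[OF S e[unfolded Cut], of i j] by auto
  qed
  ultimately show ?thesis by (simp add: esTam_less_def)
qed

section \<open>Covers are the results of moves\<close>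

text \<open>Each move changes one of the three predicates at its own cell in a way that no other
  enabled move does.\<close>

lemma results_incomparable:
  assumes S: "S \<in> fb_tableaux n" and e: "enabled n S l" and e': "enabled n S l'"
    and le: "esTam_le n (result n S l) (result n S l')"
  shows "l = l'"
proof -
  let ?R = "result n S l" and ?R' = "result n S l'"
  note le' = le[unfolded esTam_le_iff[OF result_fb[OF S e] result_fb[OF S e']], rule_format]
  show ?thesis
  proof (cases l)
    case (Up i j)
    have in_: "inner n i j" using enabled_inner(1)[OF S e[unfolded Up]] .
    have n: "\<not> hasup S i j" "2 \<le> i" "(i, j) \<in> S" using e Up by auto
    have "hasup ?R i j"
      using result_Up(2)[OF S e[unfolded Up], of i j] landing(1)[OF S n(2), of j] Up by auto
    then have R': "hasup ?R' i j" using le'[OF in_] by blast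
    show ?thesis
    proof (cases l')
      case l': (Up i' j')
      then have j: "j' = j" using R' n result_Up(2)[OF S e'[unfolded l'], of i j] by auto
      have "\<not> i < i'" "\<not> i' < i" using e' n j l' by (auto simp: hasup_def)
      then show ?thesis using Up l' j by auto
    next
      case l': (Fill i' j')
      then show ?thesis using R' n result_Fill(2)[OF S e'[unfolded l'], of i j] by auto
    next
      case l': (Cut i' j')
      then show ?thesis using R' n result_Cut(2)[OF S e'[unfolded l'], of i j] by auto
    qed
  next
    case (Fill i j)
    have in_: "inner n i j" using enabled_inner(2)[OF S e[unfolded Fill]] .
    have n: "\<not> filled S i j" "hasup S i j" using e Fill by (auto simp: filled_def)
    have "filled ?R i j" using result_Fill(4)[OF S e[unfolded Fill], of i j] Fill by auto
    then have R': "filled ?R' i j" using le'[OF in_] by blast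
    show ?thesis
    proof (cases l')
      case l': (Up i' j')
      \<comment> \<open>A lift fills only cells weakly above its arrow, so the arrow would inherit
        \<open>hasup\<close> from (i, j).\<close>
      then have "j' = j" "i \<le> i'" using R' n result_Up(4)[OF S e'[unfolded l'] in_] by auto
      then have "hasup S i' j'" using n(2) hasup_mono by auto
      then show ?thesis using e' l' by auto
    next
      case l': (Fill i' j')
      then show ?thesis using R' n Fill result_Fill(4)[OF S e'[unfolded l'], of i j] by auto
    next
      case l': (Cut i' j')
      then show ?thesis using R' n result_Cut(4)[OF S e'[unfolded l'], of i j] by auto
    qed
  next
    case (Cut i j)
    have in_: "inner n i j" using enabled_inner(3)[OF S e[unfolded Cut]] .
    then have i1: "i \<noteq> 1" by (auto simp: inner_def)
    have n: "hasleft S i j" "(i, j) \<in> S" using e Cut by auto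
    have "\<not> hasleft ?R i j" using result_Cut(3)[OF S e[unfolded Cut], of i j] Cut by auto
    then have R': "\<not> hasleft ?R' i j" using le'[OF in_] by blast
    show ?thesis
    proof (cases l')
      case l': (Up i' j')
      then show ?thesis using R' n result_Up(3)[OF S e'[unfolded l'] i1, of j] by auto
    next
      case l': (Fill i' j')
      then show ?thesis using R' n result_Fill(3)[OF S e'[unfolded l'], of i j] by auto
    next
      case l': (Cut i' j')
      then have "i' = i" "j' \<le> j" using R' n result_Cut(3)[OF S e'[unfolded l'], of i j] by auto
      \<comment> \<open>Otherwise the gap condition for the cut at j' would forbid the nonempty cell
        (i, j).\<close>
      moreover have "\<not> j' < j" using e' n l' \<open>i' = i\<close> by auto
      ultimately show ?thesis using Cut l' by auto
    qed
  qed
qed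


text \<open>Differences are sought first in \<open>hasup\<close>, then at empty free cells of
  \<open>S\<close>, and last in \<open>hasleft\<close>; a cut is available in the last case because
  the first two kinds are absent.\<close>

lemma move_towards:
  assumes S: "S \<in> fb_tableaux n" and T: "T \<in> fb_tableaux n" and less: "esTam_less n S T"
  obtains l where "enabled n S l" "esTam_le n (result n S l) T"
proof -
  have le: "esTam_le n S T" and neq: "S \<noteq> T" using less by (auto simp: esTam_less_def)
  note le' = le[unfolded esTam_le_iff[OF S T], rule_format]
  consider (up) a b where "inner n a b" "hasup T a b" "\<not> hasup S a b"
    | (fill) a b where "\<And>i j. inner n i j \<Longrightarrow> hasup S i j \<longleftrightarrow> hasup T i j"
        "inner n a b" "hasup S a b" "hasleft S a b" "(a, b) \<notin> S" "\<not> hasleft T a b \<or> (a, b) \<in> T"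
    | (cut) "\<And>i j. inner n i j \<Longrightarrow> hasup S i j \<longleftrightarrow> hasup T i j"
        "\<And>i j. inner n i j \<Longrightarrow> hasup S i j \<Longrightarrow> hasleft S i j \<Longrightarrow> \<not> hasleft T i j \<or> (i, j) \<in> T \<Longrightarrow> (i, j) \<in> S"
    using le' by blast
  then show thesis
  proof cases
    case up
    have b: "1 \<le> b" "b < n" "2 \<le> a" using up(1) by (auto simp: inner_def)
    obtain i where i: "(i, b) \<in> S" "\<not> hasup S i b"
      using topmost[OF fb_border[OF S b(1,2)]] by blast
    have ai: "a \<le> i" using i(1) up(3) by (auto simp: hasup_def not_less[symmetric])
    have e: "enabled n S (Up i b)" using i ai b(3) by simp
    let ?R = "result n S (Up i b)" and ?p = "landing S i b"
    have i2: "2 \<le> i" using ai b by simp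
    note p = landing[OF S i2, of b]
    obtain k where "k < a" "(k, b) \<in> T" using up(2) by (auto simp: hasup_def)
    then obtain m where m: "m < a" "(m, b) \<in> T" "\<not> hasup T m b"
      using topmost[of k b T] by (metis le_less_trans)
    \<comment> \<open>The top cell of column b in \<open>T\<close> needs a cell to its left in
      \<open>T\<close>, hence also in \<open>S\<close>, so it cannot lie strictly between the
      landing row and row i.\<close>
    have mp: "m \<le> ?p"
    proof (rule ccontr)
      assume "\<not> m \<le> ?p"
      then have m2: "2 \<le> m" "?p < m" "m < i" using p(2) m(1) ai by auto
      have "hasleft T m b" using fb_arrow[OF T m(2)] m(3) b(2) by auto
      then have "hasleft S m b" using le' board_inner[OF fb_board[OF T m(2)] m2(1) b(2)] by blast
      then show False using p(4) m2 by blast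
    qed
    have T_up: "hasup T a' b" if "?p < a'" for a'
      using that mp m(2) unfolding hasup_def by (intro exI[of _ m]) auto
    have "esTam_le n ?R T"
      unfolding esTam_le_iff[OF result_fb[OF S e] T]
    proof (intro allI impI conjI)
      fix a' b' assume in_: "inner n a' b'"
      then have a1: "a' \<noteq> 1" by (auto simp: inner_def)
      show "hasup T a' b'" if "hasup ?R a' b'"
        using that T_up le'[OF in_] unfolding result_Up(2)[OF S e] by blast
      show "hasleft ?R a' b'" if "hasleft T a' b'"
        using that le'[OF in_] unfolding result_Up(3)[OF S e a1] by blast
      show "filled T a' b'" if "filled ?R a' b'"
      proof -
        consider "filled S a' b'" | "b' = b" "?p < a'" "a' < i" | "b' = b" "?p < a'" "a' = Suc b"
          using \<open>filled ?R a' b'\<close> unfolding result_Up(4)[OF S e in_] by blast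
        then show ?thesis
        proof cases
          case 1 then show ?thesis using le'[OF in_] by blast
        next
          case 2
          then have "\<not> hasleft T a' b'" using p(4) le'[OF in_] by blast
          then show ?thesis using T_up 2 by (simp add: filled_def)
        next
          case 3
          then show ?thesis using T_up fb_border[OF T b(1,2)] by (simp add: filled_def)
        qed
      qed
    qed
    then show thesis using e that by blast
  next
    case fill
    have e: "enabled n S (Fill a b)" using fill by simp
    have "esTam_le n (result n S (Fill a b)) T"
      unfolding esTam_le_iff[OF result_fb[OF S e] T] result_Fill(2-)[OF S e]
      using le' fill by (auto simp: filled_def)
    then show thesis using e that by blast
  next
    case cut
    have "\<exists>a b. inner n a b \<and> hasleft S a b \<and> \<not> hasleft T a b"
    proof (rule ccontr)
      assume "\<not> ?thesis"
      then have left: "hasleft S a b \<longleftrightarrow> hasleft T a b" if "inner n a b" for a b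
        using le' that by blast
      have "filled S a b \<longleftrightarrow> filled T a b" if "inner n a b" for a b
        using le' cut left that unfolding filled_def by blast
      then have "esTam_le n T S" unfolding esTam_le_iff[OF T S] using cut(1) left by blast
      then show False using esTam_le_antisym[OF S T le] neq by blast
    qed
    then obtain a b where ab: "inner n a b" "hasleft S a b" "\<not> hasleft T a b" by blast
    have a: "2 \<le> a" "a \<le> Suc b" "b < n" using ab(1) by (auto simp: inner_def)
    have "(a, a - 1) \<in> T" using fb_border[OF T, of "a - 1"] a by simp
    then obtain j where j: "a - 1 \<le> j" "(a, j) \<in> T" "\<not> hasleft T a j" using leftmost[OF T] by blast
    have jb: "j \<le> b" using j(2) ab(3) by (auto simp: hasleft_def not_less[symmetric])
    have in_: "inner n a j" using j(1) jb a by (auto simp: inner_def)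
    have "hasup T a j" using fb_arrow[OF T j(2)] j(3) a by auto
    then have Sj: "hasup S a j" "hasleft S a j" using cut(1) in_ ab(2) jb hasleft_anti by blast+
    \<comment> \<open>The maximum labels the leftmost free cell of row a in \<open>S\<close>, the
      first stop of the retreating left-arrow. It is weakly left of the left-arrow (a, j) of
      \<open>T\<close>.\<close>
    let ?K = "{k. j \<le> k \<and> hasup S a k \<and> hasleft S a k}"
    define k where "k = Max ?K"
    have "?K \<subseteq> {..n}" using hasleft_less(1)[OF S] by (auto intro: less_imp_le)
    then have fin: "finite ?K" by (rule finite_subset) simp
    have "k \<in> ?K" unfolding k_def using fin Sj by (intro Max_in) auto
    then have k: "j \<le> k" "hasup S a k" "hasleft S a k" by auto
    have ink: "inner n a k" using hasleft_less(1)[OF S k(3)] k(1) in_ by (auto simp: inner_def)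
    have "\<not> hasleft T a k" using j(3) k(1) hasleft_anti by blast
    then have kS: "(a, k) \<in> S" using cut(2)[OF ink] k by blast
    have e: "enabled n S (Cut a k)"
      unfolding enabled.simps
    proof (intro conjI allI impI kS k(2,3))
      fix m assume m: "k < m" "hasleft S a m"
      show up: "\<not> hasup S a m"
      proof
        assume "hasup S a m"
        then have "m \<in> ?K" using m k(1) by simp
        then have "m \<le> k" unfolding k_def by (rule Max_ge[OF fin])
        then show False using m(1) by simp
      qed
      \<comment> \<open>Such a cell would be an up-arrow of \<open>S\<close>. Since
        \<open>hasup\<close> agrees in rows a and a + 1, it would be nonempty in \<open>T\<close> as
        well, to the left of the left-arrow of \<open>T\<close>. On the border there is no cell
        below to compare, but the cell is nonempty in \<open>T\<close> anyway.\<close>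
      show "(a, m) \<notin> S"
      proof
        assume mS: "(a, m) \<in> S"
        have mn: "m < n" using hasleft_less(1)[OF S m(2)] .
        then have am: "inner n a m" using ink m(1) by (auto simp: inner_def)
        have "(a, m) \<in> T"
        proof (cases "a = Suc m")
          case True then show ?thesis using fb_border[OF T] mn a by simp
        next
          case False
          then have "inner n (Suc a) m" using am by (auto simp: inner_def)
          then have "hasup T (Suc a) m" using cut(1)[of "Suc a" m] mS hasup_Suc[of S a m] by simp
          moreover have "\<not> hasup T a m" using cut(1)[OF am] up by simp
          ultimately show ?thesis using hasup_Suc[of T a m] by simp
        qed
        then have "hasleft T a j" using m(1) k(1) unfolding hasleft_def by (intro exI[of _ m]) simp
        then show False using j(3) by simp
      qed
    qed
    have "\<not> hasleft T a b'" if "k \<le> b'" for b' using that k(1) j(3) hasleft_anti[of T a b' j] by auto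
    then have "esTam_le n (result n S (Cut a k)) T"
      unfolding esTam_le_iff[OF result_fb[OF S e] T] result_Cut(2-)[OF S e]
      using le' by blast
    then show thesis using e that by blast
  qed
qed

text \<open>An element strictly between \<open>S\<close> and the result of a move would lie above
  the result of some move, and incomparability forces the two moves to coincide.\<close>

lemma covered_by_iff:
  assumes S: "S \<in> fb_tableaux n"
  shows "esTam_covered_by n S T \<longleftrightarrow> (\<exists>l. enabled n S l \<and> T = result n S l)"
proof
  assume c: "esTam_covered_by n S T"
  then have T: "T \<in> fb_tableaux n" and less: "esTam_less n S T"
    and gap: "\<not> (\<exists>U\<in>fb_tableaux n. esTam_less n S U \<and> esTam_less n U T)"
    by (auto simp: esTam_covered_by_def)
  obtain l where l: "enabled n S l" "esTam_le n (result n S l) T" by (rule move_towards[OF S T less])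
  then have "\<not> esTam_less n (result n S l) T" using gap result_fb[OF S] less_result[OF S] by blast
  then have "result n S l = T" using l(2) by (simp add: esTam_less_def)
  then show "\<exists>l. enabled n S l \<and> T = result n S l" using l(1) by blast
next
  assume "\<exists>l. enabled n S l \<and> T = result n S l"
  then obtain l where e: "enabled n S l" and T: "T = result n S l" by blast
  have fT: "T \<in> fb_tableaux n" unfolding T by (rule result_fb[OF S e])
  have "\<not> (esTam_less n S U \<and> esTam_less n U T)" if U: "U \<in> fb_tableaux n" for U
  proof
    assume a: "esTam_less n S U \<and> esTam_less n U T"
    obtain l' where l': "enabled n S l'" "esTam_le n (result n S l') U"
      using move_towards[OF S U] a by blast
    have UT: "esTam_le n U T" using a by (simp add: esTam_less_def)
    have "esTam_le n (result n S l') (result n S l)"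
      using esTam_le_trans[OF result_fb[OF S l'(1)] U fT l'(2) UT] unfolding T .
    then have "l' = l" using results_incomparable[OF S l'(1) e] by blast
    then have "U = T" using esTam_le_antisym[OF U fT UT] l'(2) T by simp
    then show False using a by (simp add: esTam_less_def)
  qed
  then show "esTam_covered_by n S T"
    using S fT less_result[OF S e] T by (auto simp: esTam_covered_by_def)
qed

text \<open>Equal results would be comparable, so distinct moves give distinct covers.\<close>

lemma meet_irreducible_iff:
  "esTam_meet_irreducible n S \<longleftrightarrow> S \<in> fb_tableaux n \<and> (\<exists>!l. enabled n S l)"
proof (cases "S \<in> fb_tableaux n")
  case S: True
  have "l = l'" if "enabled n S l" "enabled n S l'" "result n S l = result n S l'" for l l'
    using results_incomparable[OF S that(1,2)] esTam_le_refl[OF result_fb[OF S that(1)]] that(3) by simp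
  then have "(\<exists>!T. \<exists>l. enabled n S l \<and> T = result n S l) \<longleftrightarrow> (\<exists>!l. enabled n S l)"
    by metis
  then show ?thesis using S by (simp add: esTam_meet_irreducible_def covered_by_iff)
qed (simp add: esTam_meet_irreducible_def)


section \<open>The tableaux with exactly one move\<close>

text \<open>In the hook all cells of row 1 are nonempty, so Cut i j is its only move.  Deleting (1, j)
  turns the dot (i, j) into an up-arrow, which blocks Cut i j and allows Up i j; deleting (i, j)
  leaves an empty free cell, which blocks Cut i j and allows Fill i j.\<close>

definition hook :: "nat \<Rightarrow> nat \<Rightarrow> nat \<Rightarrow> cell set" where
  "hook n i j = {(1, b) | b. 1 \<le> b \<and> b \<le> n} \<union> border n \<union> {(i, b) | b. i \<le> Suc b \<and> b \<le> Suc j}"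

fun irreducible_with :: "nat \<Rightarrow> move \<Rightarrow> cell set" where
  "irreducible_with n (Up i j) = hook n i j - {(1, j)}"
| "irreducible_with n (Fill i j) = hook n i j - {(i, j)}"
| "irreducible_with n (Cut i j) = hook n i j"

fun row_of :: "move \<Rightarrow> nat" where
  "row_of (Up i j) = i" | "row_of (Fill i j) = i" | "row_of (Cut i j) = i"

fun col_of :: "move \<Rightarrow> nat" where
  "col_of (Up i j) = j" | "col_of (Fill i j) = j" | "col_of (Cut i j) = j"

text \<open>The condition on \<open>Fill\<close> excludes the border, whose cells are never
  empty.\<close>

definition moves :: "nat \<Rightarrow> move set" where
  "moves n = {l. inner n (row_of l) (col_of l) \<and> (l = Fill (row_of l) (col_of l) \<longrightarrow> row_of l \<le> col_of l)}"

lemma irreducible_with_iff: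
  assumes "l \<in> moves n" and ij: "i = row_of l" "j = col_of l"
  shows "(a, b) \<in> irreducible_with n l \<longleftrightarrow>
    (a = 1 \<and> 1 \<le> b \<and> b \<le> n \<and> (l = Up i j \<longrightarrow> b \<noteq> j)) \<or> (2 \<le> a \<and> a \<le> n \<and> a = Suc b) \<or>
    (a = i \<and> i \<le> Suc b \<and> b \<le> Suc j \<and> (l = Fill i j \<longrightarrow> b \<noteq> j))"
  using assms by (cases l) (auto simp: hook_def border_iff moves_def inner_def)

text \<open>The left-arrow of row i has label j + 1, and every other row below row 1 has only its
  border cell among the inner cells. Something lies above each inner cell because row 1 is full,
  except for \<open>Up\<close> in column j down to row i.\<close>

lemma
  assumes l: "l \<in> moves n" and ij: "i = row_of l" "j = col_of l" and ab: "inner n a b"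
  shows hasup_irreducible_with:
      "hasup (irreducible_with n l) a b \<longleftrightarrow> \<not> (l = Up i j \<and> b = j \<and> a \<le> i)"
    and hasleft_irreducible_with: "hasleft (irreducible_with n l) a b \<longleftrightarrow> a = i \<and> b \<le> j"
proof -
  note mem = irreducible_with_iff[OF l ij]
  have inn: "2 \<le> i" "i \<le> Suc j" "j < n" and abn: "2 \<le> a" "a \<le> Suc b" "b < n"
    using l ij ab by (auto simp: moves_def inner_def)
  show "hasup (irreducible_with n l) a b \<longleftrightarrow> \<not> (l = Up i j \<and> b = j \<and> a \<le> i)"
  proof (cases "l = Up i j \<and> b = j")
    case True
    show ?thesis
    proof (cases "a \<le> i")
      case True
      then show ?thesis
        unfolding hasup_def mem using inn abn \<open>l = Up i j \<and> b = j\<close> by auto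
    next
      case False
      then show ?thesis using inn abn True unfolding hasup_def mem by (intro iffI exI[of _ i]) auto
    qed
  next
    case False
    then have "hasup (irreducible_with n l) a b"
      using abn unfolding hasup_def mem by (intro exI[of _ 1]) auto
    then show ?thesis using False by blast
  qed
  show "hasleft (irreducible_with n l) a b \<longleftrightarrow> a = i \<and> b \<le> j"
  proof
    assume "hasleft (irreducible_with n l) a b"
    then show "a = i \<and> b \<le> j" using abn by (auto simp: hasleft_def mem)
  next
    assume "a = i \<and> b \<le> j"
    then show "hasleft (irreducible_with n l) a b"
      using inn unfolding hasleft_def mem by (intro exI[of _ "Suc j"]) auto
  qed
qed

lemma irreducible_with_fb:
  assumes l: "l \<in> moves n"
  shows "irreducible_with n l \<in> fb_tableaux n"
proof -
  define i j where ij: "i = row_of l" "j = col_of l"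
  let ?S = "irreducible_with n l"
  note mem = irreducible_with_iff[OF l ij]
  have inn: "inner n i j" using l ij by (simp add: moves_def)
  then have in': "2 \<le> i" "i \<le> Suc j" "j < n" by (auto simp: inner_def)
  have root: "(1, n) \<in> ?S" using in' by (auto simp: mem)
  show ?thesis
    unfolding fb_iff
  proof (intro conjI allI impI subrelI root)
    fix a b assume "(a, b) \<in> ?S" then show "(a, b) \<in> board n" using in' by (auto simp: mem board_iff)
  next
    fix b assume "1 \<le> b \<and> b < n" then show "(Suc b, b) \<in> ?S" by (auto simp: mem)
  next
    fix a b assume ab: "(a, b) \<in> ?S \<and> (a, b) \<noteq> (1, n)"
    then have "b \<le> n" "a = 1 \<and> b \<noteq> n \<or> 2 \<le> a \<and> a \<le> Suc b" using in' by (auto simp: mem)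
    then consider "a = 1" "b < n" | "2 \<le> a" "b = n" | "inner n a b"
      by (cases "b = n") (auto simp: inner_def)
    then show "hasleft ?S a b \<or> hasup ?S a b"
    proof cases
      case 1 then show ?thesis using root by (auto simp: hasleft_def)
    next
      case 2
      then have "hasup ?S a b" using root unfolding hasup_def by (intro exI[of _ 1]) auto
      then show ?thesis ..
    next
      case 3
      have "a = i" if "b = j" "a \<le> i" using ab that in' 3 by (auto simp: mem inner_def)
      then show ?thesis
        using hasup_irreducible_with[OF l ij 3] hasleft_irreducible_with[OF l ij 3] by auto
    qed
  qed
qed

lemma enabled_irreducible_with:
  assumes l: "l \<in> moves n"
  shows "enabled n (irreducible_with n l) l' \<longleftrightarrow> l' = l"
proof -
  define i j where ij: "i = row_of l" "j = col_of l"
  let ?S = "irreducible_with n l"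
  note mem = irreducible_with_iff[OF l ij]
  note up = hasup_irreducible_with[OF l ij] and left = hasleft_irreducible_with[OF l ij]
  note fb = irreducible_with_fb[OF l]
  have inn: "inner n i j" using l ij by (simp add: moves_def)
  have Fill: "i \<le> j" if "l = Fill i j" using l that by (simp add: moves_def)
  have kinds: "l = Up i j \<or> l = Fill i j \<or> l = Cut i j" using ij by (cases l) auto
  show ?thesis
  proof
    assume e: "enabled n ?S l'"
    show "l' = l"
    proof (cases l')
      case (Up a b)
      then have ab: "inner n a b" using enabled_inner(1)[OF fb] e by blast
      have *: "(a, b) \<in> ?S" "l = Up i j \<and> b = j \<and> a \<le> i" using e Up up[OF ab] by auto
      then have "a = i" using ab inn unfolding mem inner_def by auto
      then show ?thesis using * Up by simp
    next
      case (Fill a b)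
      then have ab: "inner n a b" using enabled_inner(2)[OF fb] e by blast
      have "(a, b) \<notin> ?S" "\<not> (l = Up i j \<and> b = j \<and> a \<le> i)" "a = i \<and> b \<le> j"
        using e Fill up[OF ab] left[OF ab] by auto
      then have "l = Fill i j \<and> b = j" using ab by (auto simp: mem inner_def)
      then show ?thesis using Fill \<open>a = i \<and> b \<le> j\<close> by simp
    next
      case (Cut a b)
      then have ab: "inner n a b" using enabled_inner(3)[OF fb] e by blast
      have ab': "a = i" "b \<le> j" "(a, b) \<in> ?S" "\<not> (l = Up i j \<and> b = j)"
        using e Cut up[OF ab] left[OF ab] by auto
      \<comment> \<open>Cells of row i further right are free and nonempty, but the gap condition
        for a cut there fails at (i, j), which is nonempty or has something above.\<close>
      have "\<not> b < j"
      proof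
        assume "b < j"
        then have "\<not> hasup ?S i j \<and> (i, j) \<notin> ?S" using e Cut ab'(1) left[OF inn] by auto
        then show False using up[OF inn] inn by (auto simp: mem inner_def)
      qed
      then have "b = j" using ab' by simp
      moreover from this have "l \<noteq> Fill i j" using ab' ab inn Fill by (auto simp: mem inner_def)
      ultimately show ?thesis using kinds ab' Cut by auto
    qed
  next
    assume "l' = l"
    moreover have "enabled n ?S l"
      using kinds
    proof (elim disjE)
      assume k: "l = Up i j"
      have "(i, j) \<in> ?S" unfolding mem using k inn by (auto simp: inner_def)
      moreover have "\<not> hasup ?S i j" using k up[OF inn] by simp
      ultimately have "enabled n ?S (Up i j)" using inn by (simp add: inner_def)
      then show ?thesis using k by simp
    next
      assume k: "l = Fill i j"
      have "(i, j) \<notin> ?S" unfolding mem using k inn Fill by (auto simp: inner_def)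
      then have "enabled n ?S (Fill i j)" using inn k up[OF inn] left[OF inn] by simp
      then show ?thesis using k by simp
    next
      assume k: "l = Cut i j"
      have "(i, j) \<in> ?S" unfolding mem using k inn by (auto simp: inner_def)
      moreover have "\<not> hasleft ?S i m" if "j < m" for m
        using that inn by (auto simp: hasleft_def mem inner_def)
      ultimately have "enabled n ?S (Cut i j)" using k up[OF inn] left[OF inn] by simp
      then show ?thesis using k by simp
    qed
    ultimately show "enabled n ?S l'" by simp
  qed
qed

text \<open>Each deviation from the claimed shape would produce a second move. This settles the gaps
  of row 1, then the positions of the left-arrows, and finally the cells of row i.\<close>

lemma eq_irreducible_with:
  assumes S: "S \<in> fb_tableaux n" and u: "\<And>l'. enabled n S l' \<longleftrightarrow> l' = l"
  shows "l \<in> moves n" and "S = irreducible_with n l"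
proof -
  define i j where ij: "i = row_of l" "j = col_of l"
  have kinds: "l = Up i j \<or> l = Fill i j \<or> l = Cut i j" using ij by (cases l) auto
  have e: "enabled n S l" using u by simp
  have inn: "inner n i j" using kinds e enabled_inner[OF S] by auto
  have in': "2 \<le> i" "i \<le> Suc j" "j < n" using inn by (auto simp: inner_def)
  show l: "l \<in> moves n"
    unfolding moves_def mem_Collect_eq ij[symmetric]
  proof (intro conjI inn impI)
    assume "l = Fill i j"
    then have "(i, j) \<notin> S" using e by simp
    then have "i \<noteq> Suc j" using fb_border[OF S, of j] in' by auto
    then show "i \<le> j" using in' by simp
  qed
  have up: "l = Up i j \<and> b = j \<and> a \<le> i" if ab: "inner n a b" "\<not> hasup S a b" for a b
  proof -
    have "1 \<le> b" "b < n" "2 \<le> a" using ab(1) by (auto simp: inner_def)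
    then obtain k where k: "(k, b) \<in> S" "\<not> hasup S k b" using topmost[OF fb_border[OF S]] by blast
    have "a \<le> k" using k(1) ab(2) by (auto simp: hasup_def not_less[symmetric])
    then have "enabled n S (Up k b)" using k \<open>2 \<le> a\<close> by simp
    then have "Up k b = l" using u by blast
    then show ?thesis using ij \<open>a \<le> k\<close> by auto
  qed
  \<comment> \<open>An arrow off the border has an inner right neighbour. With something above, this
    neighbour admits a fill or a cut and is the cell of \<open>l\<close>; otherwise
    \<open>up\<close> makes \<open>l\<close> a lift and puts the neighbour in column j.\<close>
  have row: "a = i \<and> m = Suc j" if am: "(a, m) \<in> S" "\<not> hasleft S a m" "2 \<le> a" "a \<le> m" for a m
  proof -
    obtain k where m: "m = Suc k" using am by (cases m) auto
    have ak: "inner n a k" using fb_board[OF S am(1)] am m by (auto simp: board_iff inner_def)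
    have left: "hasleft S a k" using am(1) m hasleft_Suc[of S a k] by simp
    have beyond: "\<not> hasleft S a m'" if "k < m'" for m' using that am(2) m hasleft_anti[of S a m' m] by auto
    show ?thesis
    proof (cases "hasup S a k")
      case True
      have "enabled n S (Cut a k) \<or> enabled n S (Fill a k)" using True left ak beyond by auto
      then have "Cut a k = l \<or> Fill a k = l" using u by blast
      then show ?thesis using ij m by auto
    next
      case False
      then have k: "l = Up i j" "k = j" "a \<le> i" using up[OF ak] by auto
      have "a = i"
      proof (rule ccontr)
        assume "a \<noteq> i"
        then have aj: "a < i" using k by simp
        have aS: "(a, j) \<notin> S"
        proof
          assume "(a, j) \<in> S"
          then have "enabled n S (Up a j)" using False k am(3) by simp
          then have "Up a j = l" using u by blast
          then show False using k \<open>a \<noteq> i\<close> by simp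
        qed
        \<comment> \<open>One cell further right: (a, j) is empty with nothing above, so it blocks
          no cut, while (a, j - 1) is free by \<open>up\<close> and admits a cut or a fill although
          \<open>l\<close> is a lift. As 2 \<le> a < i \<le> j + 1, the subtraction is genuine and
          the cell lies on the board.\<close>
        have in2: "inner n a (j - 1)" using aj in' am(3) by (auto simp: inner_def)
        have "j - 1 \<noteq> j" using aj in' am(3) by auto
        then have "hasup S a (j - 1)" using up[OF in2] by blast
        moreover have "hasleft S a (j - 1)" using hasleft_anti[OF left, of "j - 1"] k by simp
        moreover have "\<not> hasup S a m' \<and> (a, m') \<notin> S" if m': "j - 1 < m'" "hasleft S a m'" for m'
        proof -
          have "m' = j" using m' beyond[of m'] k by (cases "j < m'") auto
          then show ?thesis using aS False k by simp
        qed
        ultimately have "enabled n S (Cut a (j - 1)) \<or> enabled n S (Fill a (j - 1))"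
          using in2 by auto
        then have "Cut a (j - 1) = l \<or> Fill a (j - 1) = l" using u by blast
        then show False using k by auto
      qed
      then show ?thesis using m k by simp
    qed
  qed
  have left: "hasleft S i j"
    using kinds e fb_arrow[OF S, of i j] in' by auto
  then obtain k where k: "j < k" "(i, k) \<in> S" by (auto simp: hasleft_def)
  obtain m where m: "k \<le> m" "(i, m) \<in> S" "\<not> hasleft S i m" using leftmost[OF S k(2)] by blast
  have "m = Suc j" using row[OF m(2,3)] in' k m by auto
  then have last: "(i, Suc j) \<in> S" "\<not> hasleft S i (Suc j)" using m by auto
  note mem = irreducible_with_iff[OF l ij]
  have "(a, b) \<in> S \<longleftrightarrow> (a, b) \<in> irreducible_with n l" if ab: "(a, b) \<in> board n" for a b
  proof -
    consider "a = 1" "b = n" | "a = 1" "inner n 2 b" | "2 \<le> a" "a \<noteq> i" | "a = i" "Suc j < b"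
      | "a = i" "b = Suc j" | "a = i" "b = j" | "a = i" "b < j"
    proof -
      have "a = 1 \<and> b = n \<or> a = 1 \<and> 1 \<le> b \<and> b < n \<or> 2 \<le> a \<and> a \<noteq> i \<or> a = i"
        using ab unfolding board_iff by linarith
      then show thesis using that by (auto simp: inner_def) linarith
    qed
    then show ?thesis
    proof cases
      case 1 then show ?thesis using fb_root[OF S] in' by (auto simp: mem)
    next
      case 2
      then have b: "1 \<le> b" "b < n" by (auto simp: inner_def)
      have h: "hasup S 2 b \<longleftrightarrow> (1, b) \<in> S"
        using hasup_Suc[of S 1 b] hasup_inner[OF S, of 1 b] by (auto simp: numeral_2_eq_2)
      show ?thesis
      proof (cases "l = Up i j \<and> b = j")
        case True
        then have "\<not> hasup S i j" using e by auto
        then have "\<not> hasup S 2 b" using True hasup_mono in' by blast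
        then show ?thesis using True h 2 in' by (auto simp: mem)
      next
        case False
        then have "hasup S 2 b" using up 2 by blast
        then show ?thesis using False h 2 b by (auto simp: mem)
      qed
    next
      case 3
      \<comment> \<open>By \<open>row\<close>, the left-arrow of any row other than i is its border
        cell, which is the last cell of the row.\<close>
      have "(a, b) \<in> S \<longleftrightarrow> a = Suc b \<and> a \<le> n"
      proof
        assume "(a, b) \<in> S"
        then obtain m where m: "b \<le> m" "(a, m) \<in> S" "\<not> hasleft S a m" using leftmost[OF S] by blast
        then have "\<not> a \<le> m" using row[OF m(2,3)] 3 by auto
        then show "a = Suc b \<and> a \<le> n" using ab m by (auto simp: board_iff)
      next
        assume "a = Suc b \<and> a \<le> n"
        then show "(a, b) \<in> S" using fb_border[OF S] 3 by auto
      qed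
      then show ?thesis using 3 by (auto simp: mem)
    next
      case 4
      then show ?thesis using last(2) in' by (auto simp: mem hasleft_def)
    next
      case 5
      then show ?thesis using last(1) in' by (auto simp: mem)
    next
      case 6
      have "(i, j) \<in> S \<longleftrightarrow> l \<noteq> Fill i j" using kinds e by auto
      moreover have "i \<le> j" if "l = Fill i j" using l that by (simp add: moves_def)
      ultimately show ?thesis unfolding 6 mem using in' by auto
    next
      case 7
      then have ib: "inner n i b" using ab in' by (auto simp: board_iff inner_def)
      have "hasup S i b" using up[OF ib] 7 by auto
      moreover have "hasleft S i b" using hasleft_anti[OF left] 7 by simp
      \<comment> \<open>If empty, this free cell would admit a second move.\<close>
      moreover have "\<not> enabled n S (Fill i b)" unfolding u using ij(2) 7(2) by (cases l) auto
      ultimately have "(i, b) \<in> S" using ib by auto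
      then show ?thesis using 7 ib by (auto simp: mem inner_def)
    qed
  qed
  then show "S = irreducible_with n l"
    using fb_board[OF S] fb_board[OF irreducible_with_fb[OF l]] by auto
qed

lemma meet_irreducibles_eq: "{T. esTam_meet_irreducible n T} = irreducible_with n ` moves n"
proof (intro set_eqI iffI)
  fix S assume "S \<in> {T. esTam_meet_irreducible n T}"
  then have S: "S \<in> fb_tableaux n" "\<exists>!l. enabled n S l" by (auto simp: meet_irreducible_iff)
  then obtain l where "\<And>l'. enabled n S l' \<longleftrightarrow> l' = l" by blast
  then show "S \<in> irreducible_with n ` moves n" using eq_irreducible_with[OF S(1)] by blast
next
  fix S assume "S \<in> irreducible_with n ` moves n"
  then show "S \<in> {T. esTam_meet_irreducible n T}"
    using irreducible_with_fb by (auto simp: meet_irreducible_iff enabled_irreducible_with)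
qed

section \<open>Counting\<close>

text \<open>Column j contributes rows 2 to j + 1, that is j cells, so the column added in the
  induction step has n of them.\<close>

lemma card_inner: "finite {(i, j). inner n i j} \<and> card {(i, j). inner n i j} = n choose 2"
proof (induction n)
  case 0
  then show ?case by (simp add: inner_def)
next
  case (Suc n)
  have eq: "{(i, j). inner (Suc n) i j} = {(i, j). inner n i j} \<union> (\<lambda>i. (i, n)) ` {2..Suc n}"
    by (auto simp: inner_def)
  have "card ((\<lambda>i. (i, n)) ` {2..Suc n}) = n" by (simp add: card_image inj_on_def)
  moreover have "{(i, j). inner n i j} \<inter> (\<lambda>i. (i, n)) ` {2..Suc n} = {}" by (auto simp: inner_def)
  ultimately show ?case using Suc by (simp add: eq card_Un_disjoint numeral_2_eq_2)
qed

lemma card_moves: "card (moves n) = 2 * (n choose 2) + ((n - 1) choose 2)"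
proof -
  let ?I = "{(i, j). inner n i j}" and ?J = "{(i, j). inner (n - 1) i j}"
  \<comment> \<open>Lowering the column label by one identifies the inner cells off the border with
    the inner cells for size n - 1.\<close>
  have eq: "moves n = (\<lambda>(i, j). Up i j) ` ?I \<union> (\<lambda>(i, j). Cut i j) ` ?I \<union> (\<lambda>(i, j). Fill i (Suc j)) ` ?J"
    (is "_ = ?A \<union> ?B \<union> ?C")
  proof (intro set_eqI)
    fix l show "l \<in> moves n \<longleftrightarrow> l \<in> ?A \<union> ?B \<union> ?C"
    proof (cases l)
      case (Fill i j)
      then show ?thesis by (cases j) (auto simp: moves_def inner_def image_iff)
    qed (auto simp: moves_def image_iff)
  qed
  have "card ?A = n choose 2" "card ?B = n choose 2" "card ?C = (n - 1) choose 2"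
    using card_inner by (auto simp: card_image inj_on_def)
  moreover have "finite ?A" "finite ?B" "finite ?C" using card_inner by auto
  moreover have "?A \<inter> ?B = {}" "(?A \<union> ?B) \<inter> ?C = {}" by auto
  ultimately show ?thesis unfolding eq by (simp add: card_Un_disjoint)
qed

theorem corollary5p3:
  fixes n :: nat
  assumes "n \<ge> 1"
  shows "card {T. esTam_meet_irreducible n T} = 2 * (n choose 2) + ((n - 1) choose 2)"
proof -
  have "inj_on (irreducible_with n) (moves n)"
    \<comment> \<open>The tableau determines \<open>l\<close> as its only enabled move.\<close>
    by (intro inj_onI) (metis enabled_irreducible_with)
  then show ?thesis unfolding meet_irreducibles_eq by (simp add: card_image card_moves)
qed

end
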